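(* Let $\gamma$ be a regular time-like curve in $\mathbb{L}^4$. (1) If $\gamma$ admits a generalized Bishop frame of type F, then $\gamma$ also admits a generalized Bishop frame of type D. (2) If $\gamma$ admits a generalized Bishop frame of type D, then $\gamma$ also admits a generalized Bishop frame of type C.
   Context: $\mathbb{L}^4$ is $\mathbb{R}^4$ with the Lorentzian inner product $\langle\cdot,\cdot\rangle$ of signature $(-,+,+,+)$. Curves $\gamma: I\to\mathbb{L}^4$ are smooth and defined on an open interval $I$. A regular time-like curve is one with $\langle\gamma',\gamma'\rangle<0$ everywhere. It is parametrized by proper time $s$, so that $\mathbb{T}=\gamma'$ satisfies $\langle\mathbb{T},\mathbb{T}\rangle=-1$, and $'$ denotes $d/ds$. An orthonormal frame of $\gamma$ is a smooth family $\{\mathbb{T},\mathbb{Z}_1,\mathbb{Z}_2,\mathbb{Z}_3\}$ along $\gamma$ whose first vector is $\mathbb{T}$, with $\langle\mathbb{T},\mathbb{Z}_i\rangle=0$ and $\langle\mathbb{Z}_i,\mathbb{Z}_j\rangle=\delta_{ij}$. Writing $\mathbb{Z}$ for the matrix with rows $\mathbb{T},\mathbb{Z}_1,\mathbb{Z}_2,\mathbb{Z}_3$, its coefficient matrix is the matrix-valued function $X$ with $\mathbb{Z}'=X\mathbb{Z}$. The frame is called a generalized Bishop frame of type C, D, F respectively if, after some permutation of the last three vectors, its coefficient matrix has the respective form below for some smooth functions $x_1,x_2,x_3$ on $I$ (zeros allowed): $$\text{C}:\begin{pmatrix}0&x_1&x_2&0\\ x_1&0&0&x_3\\ x_2&0&0&0\\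 0&-x_3&0&0\end{pmatrix},\quad \text{D}:\begin{pmatrix}0&x_1&0&0\\ x_1&0&x_2&x_3\\ 0&-x_2&0&0\\ 0&-x_3&0&0\end{pmatrix},\quad \text{F}:\begin{pmatrix}0&x_1&0&0\\ x_1&0&x_2&0\\ 0&-x_2&0&x_3\\ 0&0&-x_3&0\end{pmatrix}.$$ *)

theory Defs
  imports "HOL-Analysis.Analysis"
begin

text \<open>
  Derivatives of all orders exist at every point of \<open>S\<close>. This is meant for open \<open>S\<close>, where the
  values of \<open>f\<close> outside \<open>S\<close> do not matter.
\<close>

definition smooth_on :: "real set \<Rightarrow> (real \<Rightarrow> 'a::real_normed_vector) \<Rightarrow> bool" where
  "smooth_on S f \<longleftrightarrow>
     (\<forall>n. \<forall>t\<in>S. ((\<lambda>g s. vector_derivative g (at s)) ^^ n) f differentiable at t)"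

text \<open>
  The index type \<open>4\<close> has the elements \<open>1, 2, 3, 4\<close> (with \<open>4 = 0\<close>); the time coordinate is \<open>1\<close>.
\<close>

definition lorentz_inner :: "real^4 \<Rightarrow> real^4 \<Rightarrow> real" where
  "lorentz_inner v w = - (v$1 * w$1) + v$2 * w$2 + v$3 * w$3 + v$4 * w$4"

definition regular_timelike_curve :: "real set \<Rightarrow> (real \<Rightarrow> real^4) \<Rightarrow> bool" where
  "regular_timelike_curve I \<gamma> \<longleftrightarrow>
     open I \<and> is_interval I \<and> smooth_on I \<gamma> \<and>
     (\<forall>t\<in>I. lorentz_inner (vector_derivative \<gamma> (at t)) (vector_derivative \<gamma> (at t)) < 0)"

definition proper_time_parametrized :: "real set \<Rightarrow> (real \<Rightarrow> real^4) \<Rightarrow> bool" where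
  "proper_time_parametrized I \<gamma> \<longleftrightarrow>
     (\<forall>s\<in>I. lorentz_inner (vector_derivative \<gamma> (at s)) (vector_derivative \<gamma> (at s)) = -1)"

text \<open>
  A frame is given by its matrix \<open>Z\<close>: the rows \<open>Z s $ 1, \<dots>, Z s $ 4\<close> are the vectors
  \<open>T, Z\<^sub>1, Z\<^sub>2, Z\<^sub>3\<close> at \<open>s\<close>.
\<close>

definition orthonormal_frame :: "real set \<Rightarrow> (real \<Rightarrow> real^4) \<Rightarrow> (real \<Rightarrow> real^4^4) \<Rightarrow> bool" where
  "orthonormal_frame I \<gamma> Z \<longleftrightarrow>
     smooth_on I Z \<and>
     (\<forall>s\<in>I. Z s $ 1 = vector_derivative \<gamma> (at s) \<and>
        (\<forall>i\<in>{2,3,4}. lorentz_inner (Z s $ 1) (Z s $ i) = 0) \<and>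
        (\<forall>i\<in>{2,3,4}. \<forall>j\<in>{2,3,4}. lorentz_inner (Z s $ i) (Z s $ j) = (if i = j then 1 else 0)))"

definition has_coefficient_matrix ::
    "real set \<Rightarrow> (real \<Rightarrow> real^4^4) \<Rightarrow> (real \<Rightarrow> real^4^4) \<Rightarrow> bool" where
  "has_coefficient_matrix I Z X \<longleftrightarrow> (\<forall>s\<in>I. (Z has_vector_derivative X s ** Z s) (at s))"

lemma vector_4:
  "(vector [a, b, c, d] :: 'a::zero^4) $ 1 = a"
  "(vector [a, b, c, d] :: 'a::zero^4) $ 2 = b"
  "(vector [a, b, c, d] :: 'a::zero^4) $ 3 = c"
  "(vector [a, b, c, d] :: 'a::zero^4) $ 4 = d"
  unfolding vector_def by simp_all

definition form_C :: "real \<Rightarrow> real \<Rightarrow> real \<Rightarrow> real^4^4" where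
  "form_C x1 x2 x3 = vector
     [vector [ 0,  x1, x2,  0],
      vector [x1,   0,  0, x3],
      vector [x2,   0,  0,  0],
      vector [ 0, -x3,  0,  0]]"

definition form_D :: "real \<Rightarrow> real \<Rightarrow> real \<Rightarrow> real^4^4" where
  "form_D x1 x2 x3 = vector
     [vector [ 0,  x1,  0,  0],
      vector [x1,   0, x2, x3],
      vector [ 0, -x2,  0,  0],
      vector [ 0, -x3,  0,  0]]"

definition form_F :: "real \<Rightarrow> real \<Rightarrow> real \<Rightarrow> real^4^4" where
  "form_F x1 x2 x3 = vector
     [vector [ 0,  x1,   0,  0],
      vector [x1,   0,  x2,  0],
      vector [ 0, -x2,   0, x3],
      vector [ 0,   0, -x3,  0]]"

definition generalized_bishop_frame ::
    "(real \<Rightarrow> real \<Rightarrow> real \<Rightarrow> real^4^4) \<Rightarrow> real set \<Rightarrow> (real \<Rightarrow> real^4) \<Rightarrow> (real \<Rightarrow> real^4^4) \<Rightarrow> bool" where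
  "generalized_bishop_frame form I \<gamma> Z \<longleftrightarrow>
     orthonormal_frame I \<gamma> Z \<and>
     (\<exists>\<pi> x1 x2 x3. \<pi> permutes {2,3,4} \<and>
        smooth_on I x1 \<and> smooth_on I x2 \<and> smooth_on I x3 \<and>
        has_coefficient_matrix I (\<lambda>s. \<chi> i. Z s $ \<pi> i) (\<lambda>s. form (x1 s) (x2 s) (x3 s)))"

definition admits_bishop_frame ::
    "(real \<Rightarrow> real \<Rightarrow> real \<Rightarrow> real^4^4) \<Rightarrow> real set \<Rightarrow> (real \<Rightarrow> real^4) \<Rightarrow> bool" where
  "admits_bishop_frame form I \<gamma> \<longleftrightarrow> (\<exists>Z. generalized_bishop_frame form I \<gamma> Z)"

end

theory Submission
  imports Defs
begin

text \<open>
  The three normal vectors of an orthonormal frame along a time-like curve span the normal bundle,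
  which is Euclidean of rank 3, so the orthonormal frames of one curve differ by a gauge
  transformation: a function \<open>R\<close> with values in the orthogonal matrices that fix the first basis
  vector. A frame with coefficient matrix \<open>X\<close> is turned into one with coefficient matrix \<open>Y\<close>
  as soon as \<open>R' = Y R - R X\<close> (\<open>gauge_transformation\<close>). The forms C, D and F are systems of
  zeros to be imposed on \<open>Y\<close>.

  Such an \<open>R\<close> arises from a linear differential equation. Split \<open>X = B + K\<close> with \<open>K\<close>
  skew-symmetric. The solution of \<open>R' = - R K\<close> with \<open>R = 1\<close> at one point is orthogonal, fixes
  the basis vectors that \<open>K\<close> annihilates, and turns the coefficient matrix into
  \<open>R B R\<^sup>T\<close>: the part \<open>K\<close> is gauged away (\<open>parallel_gauge\<close>, resting on the Picard series in
  \<open>linear_ode_exists\<close>).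

  From F to D: let \<open>K\<close> be the entries \<open>\<plusminus>x\<^sub>3\<close>, which rotate \<open>Z\<^sub>2, Z\<^sub>3\<close> into each other. In the
  new frame \<open>Z\<^sub>1'\<close> is a combination of \<open>T\<close> and both of the new normal vectors, and these two no
  longer turn into each other, which is form D.

  From D to C: let \<open>K\<close> consist of all entries of \<open>X\<close> in the normal block. The result is a frame
  with parallel normal vectors \<open>N\<^sub>2, N\<^sub>3, N\<^sub>4\<close>, in which the original vector \<open>Z\<^sub>1\<close> is a smooth
  curve \<open>n\<close> on the unit sphere and \<open>T' = x\<^sub>1 (n\<^sub>2 N\<^sub>2 + n\<^sub>3 N\<^sub>3 + n\<^sub>4 N\<^sub>4)\<close>. A smooth curve cannot
  fill the sphere, not even up to sign, so some unit vector \<open>c\<close> is never \<open>\<plusminus>n\<close>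
  (\<open>exists_unit_vector_avoiding_curve\<close>), and a constant rotation makes \<open>c\<close> the last basis vector.
  Then \<open>(n\<^sub>2, n\<^sub>3)\<close> never vanishes; normalizing it gives a smooth unit vector \<open>W\<^sub>1\<close> in the plane of
  \<open>N\<^sub>2\<close> and \<open>N\<^sub>3\<close>. With \<open>W\<^sub>2 = N\<^sub>4\<close> and \<open>W\<^sub>3\<close> the rotation of \<open>W\<^sub>1\<close> by a right angle in that
  plane, \<open>T'\<close> lies in the span of \<open>W\<^sub>1\<close> and \<open>W\<^sub>2\<close>, the vector \<open>W\<^sub>2\<close> is parallel, and
  \<open>W\<^sub>1, W\<^sub>3\<close> only turn into each other apart from the \<open>T\<close>-component of \<open>W\<^sub>1'\<close>: form C.
\<close>

section \<open>Calculus of smooth functions on an open set\<close>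

text \<open>
  Closure properties of smooth functions are proved by induction on the number of derivatives, for
  which smoothness itself offers no handle.
\<close>

definition times_differentiable_on :: "nat \<Rightarrow> real set \<Rightarrow> (real \<Rightarrow> 'a::real_normed_vector) \<Rightarrow> bool" where
  "times_differentiable_on n S f \<longleftrightarrow>
     (\<forall>k<n. \<forall>t\<in>S. ((\<lambda>g s. vector_derivative g (at s)) ^^ k) f differentiable at t)"

lemma smooth_on_iff_times_differentiable_on:
  "smooth_on S f \<longleftrightarrow> (\<forall>n. times_differentiable_on n S f)"
  unfolding smooth_on_def times_differentiable_on_def by blast

lemma times_differentiable_on_0 [simp]: "times_differentiable_on 0 S f"
  by (simp add: times_differentiable_on_def)

lemma times_differentiable_on_Suc:
  "times_differentiable_on (Suc n) S f \<longleftrightarrow>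
     (\<forall>t\<in>S. f differentiable at t) \<and>
     times_differentiable_on n S (\<lambda>s. vector_derivative f (at s))"
proof -
  have "times_differentiable_on (Suc n) S f \<longleftrightarrow>
     (\<forall>t\<in>S. f differentiable at t) \<and>
     (\<forall>k<n. \<forall>t\<in>S. ((\<lambda>g s. vector_derivative g (at s)) ^^ Suc k) f differentiable at t)"
    unfolding times_differentiable_on_def by (auto simp: less_Suc_eq_0_disj)
  then show ?thesis
    by (simp add: times_differentiable_on_def funpow_Suc_right del: funpow.simps)
qed

lemma times_differentiable_on_mono:
  "times_differentiable_on n S f \<Longrightarrow> m \<le> n \<Longrightarrow> times_differentiable_on m S f"
  by (auto simp: times_differentiable_on_def)

text \<open>
  The definition differentiates at all points of the line, but only the values on the open set \<open>S\<close>
  enter the derivatives there.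
\<close>

lemma times_differentiable_on_cong:
  assumes "open S" "\<And>t. t \<in> S \<Longrightarrow> f t = g t" "times_differentiable_on n S f"
  shows "times_differentiable_on n S g"
  using assms(2,3)
proof (induction n arbitrary: f g)
  case (Suc n)
  have f: "\<And>t. t \<in> S \<Longrightarrow> f differentiable at t"
    and f': "times_differentiable_on n S (\<lambda>s. vector_derivative f (at s))"
    using Suc.prems(2) unfolding times_differentiable_on_Suc by auto
  have der: "(g has_vector_derivative vector_derivative f (at t)) (at t)" if "t \<in> S" for t
    using f[OF that] that Suc.prems(1) unfolding vector_derivative_works
    by (rule has_vector_derivative_transform_within_open[OF _ assms(1)])
  have "times_differentiable_on n S (\<lambda>s. vector_derivative g (at s))"
    by (rule Suc.IH[OF _ f']) (rule vector_derivative_at[OF der, symmetric])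
  then show ?case
    unfolding times_differentiable_on_Suc using differentiableI_vector[OF der] by blast
qed simp

lemma times_differentiable_on_SucI:
  assumes "open S" "\<And>t. t \<in> S \<Longrightarrow> (f has_vector_derivative g t) (at t)"
    and "times_differentiable_on n S g"
  shows "times_differentiable_on (Suc n) S f"
  unfolding times_differentiable_on_Suc
proof (intro conjI ballI)
  show "f differentiable at t" if "t \<in> S" for t
    by (rule differentiableI_vector[OF assms(2)[OF that]])
  show "times_differentiable_on n S (\<lambda>s. vector_derivative f (at s))"
    by (rule times_differentiable_on_cong[OF assms(1) _ assms(3)])
      (rule vector_derivative_at[OF assms(2), symmetric])
qed

text \<open>
  A solution of a differential equation is one degree smoother than its right-hand side. If the
  right-hand side is in turn as smooth as the solution, the order of differentiability climbs
  forever. This gives the regularity of roots and of the gauge transformations without a chain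
  rule for higher derivatives.
\<close>

lemma smooth_on_bootstrap:
  assumes "open S" "\<And>t. t \<in> S \<Longrightarrow> (f has_vector_derivative g t) (at t)"
    and "\<And>n. times_differentiable_on n S f \<Longrightarrow> times_differentiable_on n S g"
  shows "smooth_on S f"
proof -
  have "times_differentiable_on n S f" for n
    by (induction n) (auto intro: times_differentiable_on_SucI assms)
  then show ?thesis
    by (simp add: smooth_on_iff_times_differentiable_on)
qed

lemma smooth_on_vector_derivative:
  "smooth_on S f \<Longrightarrow> smooth_on S (\<lambda>s. vector_derivative f (at s))"
  unfolding smooth_on_iff_times_differentiable_on using times_differentiable_on_Suc by blast

lemma smooth_on_has_vector_derivative:
  "smooth_on S f \<Longrightarrow> t \<in> S \<Longrightarrow> (f has_vector_derivative vector_derivative f (at t)) (at t)"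
  unfolding smooth_on_iff_times_differentiable_on
  using times_differentiable_on_Suc vector_derivative_works by blast

lemma smooth_on_continuous_on: "smooth_on S f \<Longrightarrow> continuous_on S f"
  by (intro continuous_at_imp_continuous_on ballI
      has_vector_derivative_continuous[OF smooth_on_has_vector_derivative])

lemma times_differentiable_on_const: "times_differentiable_on n S (\<lambda>t. c)"
  by (induction n arbitrary: c) (auto simp: times_differentiable_on_Suc)

lemma times_differentiable_on_add:
  assumes "open S" "times_differentiable_on n S f" "times_differentiable_on n S g"
  shows "times_differentiable_on n S (\<lambda>t. f t + g t)"
  using assms(2,3)
proof (induction n arbitrary: f g)
  case (Suc n)
  then show ?case
    by (intro times_differentiable_on_SucI[OF assms(1) has_vector_derivative_add])
      (auto simp: times_differentiable_on_Suc vector_derivative_works)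
qed simp

lemma times_differentiable_on_bilinear:
  assumes "bounded_bilinear p" "open S"
    and "times_differentiable_on n S f" "times_differentiable_on n S g"
  shows "times_differentiable_on n S (\<lambda>t. p (f t) (g t))"
  using assms(3,4)
proof (induction n arbitrary: f g)
  case (Suc n)
  note lower = Suc.prems[THEN times_differentiable_on_mono, of n]
  show ?case
    using Suc lower assms(2)
    by (intro times_differentiable_on_SucI[OF assms(2)
          bounded_bilinear.has_vector_derivative[OF assms(1)]] times_differentiable_on_add)
      (auto simp: times_differentiable_on_Suc vector_derivative_works)
qed simp

lemma times_differentiable_on_linear:
  assumes "bounded_linear h" "open S" "times_differentiable_on n S f"
  shows "times_differentiable_on n S (\<lambda>t. h (f t))"
  using assms(3)
proof (induction n arbitrary: f)
  case (Suc n)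
  then show ?case
    by (intro times_differentiable_on_SucI[OF assms(2)
          bounded_linear.has_vector_derivative[OF assms(1)]])
      (auto simp: times_differentiable_on_Suc vector_derivative_works)
qed simp

lemma has_vector_derivative_vec_lambda:
  fixes f :: "'n::finite \<Rightarrow> real \<Rightarrow> 'a::real_normed_vector"
  assumes "\<And>i. (f i has_vector_derivative f' i) (at t)"
  shows "((\<lambda>s. \<chi> i. f i s) has_vector_derivative (\<chi> i. f' i)) (at t)"
proof -
  have lin: "bounded_linear (\<lambda>h. h *\<^sub>R (\<chi> i. f' i))"
    by (rule bounded_linear_scaleR_left)
  have "((\<lambda>y. (1 / norm (y - t)) *\<^sub>R ((\<chi> i. f i y) - ((\<chi> i. f i t) + (y - t) *\<^sub>R (\<chi> i. f' i)))) \<longlongrightarrow> 0) (at t)"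
    (is "(?q \<longlongrightarrow> 0) _")
  proof (rule vec_tendstoI)
    fix i
    show "((\<lambda>y. ?q y $ i) \<longlongrightarrow> 0 $ i) (at t)"
      using assms[of i] by (simp add: has_vector_derivative_def has_derivative_within divide_inverse)
  qed
  then show ?thesis
    using lin by (simp add: has_vector_derivative_def has_derivative_within)
qed

lemma times_differentiable_on_vec_lambda:
  fixes f :: "'n::finite \<Rightarrow> real \<Rightarrow> 'a::real_normed_vector"
  assumes "open S" "\<And>i. times_differentiable_on n S (f i)"
  shows "times_differentiable_on n S (\<lambda>s. \<chi> i. f i s)"
  using assms(2)
proof (induction n arbitrary: f)
  case (Suc n)
  then show ?case
    by (intro times_differentiable_on_SucI[OF assms(1) has_vector_derivative_vec_lambda])
      (auto simp: times_differentiable_on_Suc vector_derivative_works)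
qed simp

lemma matrix_add_rdistrib: "(A + B) ** C = A ** C + B ** (C :: real^'p^'n)"
  by (simp add: matrix_matrix_mult_def vec_eq_iff distrib_right sum.distrib)

lemma bounded_bilinear_matrix_mult:
  "bounded_bilinear ((**) :: real^'n^'m \<Rightarrow> real^'p^'n \<Rightarrow> real^'p^'m)"
  unfolding bilinear_conv_bounded_bilinear[symmetric]
  by (simp add: bilinear_def linear_iff matrix_add_ldistrib matrix_add_rdistrib
      matrix_scalar_ac flip: scalar_matrix_assoc)

lemma smooth_on_const: "smooth_on S (\<lambda>t. c)"
  by (simp add: smooth_on_iff_times_differentiable_on times_differentiable_on_const)

lemma smooth_on_add:
  "open S \<Longrightarrow> smooth_on S f \<Longrightarrow> smooth_on S g \<Longrightarrow> smooth_on S (\<lambda>t. f t + g t)"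
  by (simp add: smooth_on_iff_times_differentiable_on times_differentiable_on_add)

lemma smooth_on_mult:
  fixes f g :: "real \<Rightarrow> real"
  shows "open S \<Longrightarrow> smooth_on S f \<Longrightarrow> smooth_on S g \<Longrightarrow> smooth_on S (\<lambda>t. f t * g t)"
  by (simp add: smooth_on_iff_times_differentiable_on
      times_differentiable_on_bilinear[OF bounded_bilinear_mult])

lemma smooth_on_matrix_mult:
  fixes A :: "real \<Rightarrow> real^'n^'m" and B :: "real \<Rightarrow> real^'p^'n"
  shows "open S \<Longrightarrow> smooth_on S A \<Longrightarrow> smooth_on S B \<Longrightarrow> smooth_on S (\<lambda>t. A t ** B t)"
  by (simp add: smooth_on_iff_times_differentiable_on
      times_differentiable_on_bilinear[OF bounded_bilinear_matrix_mult])

lemma smooth_on_linear: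
  "bounded_linear h \<Longrightarrow> open S \<Longrightarrow> smooth_on S f \<Longrightarrow> smooth_on S (\<lambda>t. h (f t))"
  by (simp add: smooth_on_iff_times_differentiable_on times_differentiable_on_linear)

lemma smooth_on_vec_nth: "open S \<Longrightarrow> smooth_on S f \<Longrightarrow> smooth_on S (\<lambda>t. f t $ i)"
  by (rule smooth_on_linear[OF bounded_linear_vec_nth])

lemma smooth_on_minus: "open S \<Longrightarrow> smooth_on S f \<Longrightarrow> smooth_on S (\<lambda>t. - f t)"
  using smooth_on_linear[OF bounded_linear_minus[OF bounded_linear_ident]] by blast

lemma smooth_on_vec_lambda:
  fixes f :: "'n::finite \<Rightarrow> real \<Rightarrow> 'a::real_normed_vector"
  shows "open S \<Longrightarrow> (\<And>i. smooth_on S (f i)) \<Longrightarrow> smooth_on S (\<lambda>s. \<chi> i. f i s)"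
  by (simp add: smooth_on_iff_times_differentiable_on times_differentiable_on_vec_lambda)

lemma smooth_on_matrix:
  fixes M :: "real \<Rightarrow> 'a::real_normed_vector^'n::finite^'m::finite"
  assumes "open S" "\<And>i j. smooth_on S (\<lambda>s. M s $ i $ j)"
  shows "smooth_on S M"
proof -
  have "smooth_on S (\<lambda>s. \<chi> i. \<chi> j. M s $ i $ j)"
    by (intro smooth_on_vec_lambda assms)
  then show ?thesis by simp
qed

text \<open>
  The function \<open>q = 1 / sqrt f\<close> solves \<open>q' = - f' q\<^sup>3 / 2\<close>, whose right-hand side is as smooth
  as \<open>q\<close> itself.
\<close>

lemma smooth_on_inverse_sqrt:
  fixes f :: "real \<Rightarrow> real"
  assumes S: "open S" and f: "smooth_on S f" and pos: "\<And>t. t \<in> S \<Longrightarrow> f t > 0"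
  shows "smooth_on S (\<lambda>t. 1 / sqrt (f t))"
proof (rule smooth_on_bootstrap[OF S])
  let ?q = "\<lambda>t. 1 / sqrt (f t)" and ?f' = "\<lambda>t. vector_derivative f (at t)"
  fix t assume t: "t \<in> S"
  have "(f has_real_derivative ?f' t) (at t)"
    using smooth_on_has_vector_derivative[OF f t]
    by (simp add: has_real_derivative_iff_has_vector_derivative)
  then have "(?q has_real_derivative (- (?f' t * (inverse (sqrt (f t)) / 2) / (sqrt (f t) * sqrt (f t))))) (at t)"
    using pos[OF t] by (auto intro!: derivative_eq_intros)
  moreover have "- (?f' t * (inverse (sqrt (f t)) / 2) / (sqrt (f t) * sqrt (f t))) =
      (- 1 / 2) * ?f' t * (?q t * (?q t * ?q t))"
    by (simp add: field_simps)
  ultimately show "(?q has_vector_derivative (- 1 / 2) * ?f' t * (?q t * (?q t * ?q t))) (at t)"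
    by (simp add: has_real_derivative_iff_has_vector_derivative)
next
  fix n assume "times_differentiable_on n S (\<lambda>t. 1 / sqrt (f t))"
  moreover have "times_differentiable_on n S (\<lambda>t. vector_derivative f (at t))"
    using smooth_on_vector_derivative[OF f] smooth_on_iff_times_differentiable_on by blast
  ultimately show "times_differentiable_on n S (\<lambda>t. (- 1 / 2) * vector_derivative f (at t) *
      (1 / sqrt (f t) * (1 / sqrt (f t) * (1 / sqrt (f t)))))"
    by (intro times_differentiable_on_bilinear[OF bounded_bilinear_mult S]
        times_differentiable_on_const)
qed

section \<open>Linear differential equations on an open interval\<close>

lemma open_interval_enlarge:
  fixes I :: "real set"
  assumes "open I" "is_interval I" "x \<in> I" "y \<in> I"
  obtains a b where "a < x" "a < y" "x < b" "y < b" "{a..b} \<subseteq> I"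
proof -
  have "min x y \<in> I" "max x y \<in> I"
    using assms by (auto simp: min_def max_def)
  then obtain e d where "e > 0" "cball (min x y) e \<subseteq> I" "d > 0" "cball (max x y) d \<subseteq> I"
    using assms(1) open_contains_cball by metis
  then have e: "e > 0" "min x y - e \<in> I" and d: "d > 0" "max x y + d \<in> I"
    by (auto simp: cball_def dist_real_def subset_iff)
  show thesis
  proof
    show "{min x y - e..max x y + d} \<subseteq> I"
      using mem_is_interval_1_I[OF assms(2) e(2) d(2)] by auto
  qed (use e d in auto)
qed

lemma antiderivative_on_open_interval:
  fixes g :: "real \<Rightarrow> 'a::banach"
  assumes I: "open I" "is_interval I" and t0: "t0 \<in> I" and g: "continuous_on I g"
  obtains G where "G t0 = 0" "\<And>t. t \<in> I \<Longrightarrow> (G has_vector_derivative g t) (at t)"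
proof -
  let ?G = "\<lambda>t. integral {t0..t} g - integral {t..t0} g"
  have "(?G has_vector_derivative g t) (at t)" if t: "t \<in> I" for t
  proof -
    from open_interval_enlarge[OF I t0 t] obtain a b
      where ab: "a < t0" "a < t" "t0 < b" "t < b" "{a..b} \<subseteq> I" by blast
    have int: "g integrable_on {c..d}" if "a \<le> c" "d \<le> b" for c d
      using ab that by (intro integrable_continuous_real continuous_on_subset[OF g]) auto
    have eq: "integral {a..s} g - integral {a..t0} g = ?G s" if s: "s \<in> {a<..<b}" for s
    proof (cases "s \<le> t0")
      case True
      then have "integral {a..s} g + integral {s..t0} g = integral {a..t0} g"
        using s ab int[of a t0] by (intro Henstock_Kurzweil_Integration.integral_combine) auto
      then show ?thesis using True by (cases "s = t0") (auto simp: algebra_simps)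
    next
      case False
      then have "integral {a..t0} g + integral {t0..s} g = integral {a..s} g"
        using s ab int[of a s] by (intro Henstock_Kurzweil_Integration.integral_combine) auto
      then show ?thesis using False by (auto simp: algebra_simps)
    qed
    have "((\<lambda>s. integral {a..s} g) has_vector_derivative g t) (at t within {a..b})"
      using ab by (intro integral_has_vector_derivative continuous_on_subset[OF g]) auto
    then have "((\<lambda>s. integral {a..s} g) has_vector_derivative g t) (at t)"
      using ab by (simp add: at_within_Icc_at)
    then have "((\<lambda>s. integral {a..s} g - integral {a..t0} g) has_vector_derivative g t) (at t)"
      by (simp add: has_vector_derivative_diff_const)
    then show ?thesis
      by (rule has_vector_derivative_transform_within_open[of _ _ _ "{a<..<b}"])
        (use ab eq in auto)
  qed
  then show thesis
    by (intro that[of ?G]) auto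
qed

text \<open>
  One integration against a factor of size \<open>M\<close> gains a factor \<open>M |t - t0| / (n + 1)\<close>.
\<close>

lemma picard_step_bound:
  fixes f :: "real \<Rightarrow> 'a::real_normed_vector"
  assumes der: "\<And>s. s \<in> {a..b} \<Longrightarrow> (f has_vector_derivative f' s) (at s)"
    and bnd: "\<And>s. s \<in> {a..b} \<Longrightarrow> norm (f' s) \<le> M * (C * (M * \<bar>s - t0\<bar>) ^ n / fact n)"
    and t0: "t0 \<in> {a..b}" "f t0 = 0" and t: "t \<in> {a..b}"
  shows "norm (f t) \<le> C * (M * \<bar>t - t0\<bar>) ^ Suc n / fact (Suc n)"
proof -
  have cont: "continuous_on {c..d} f" if "{c..d} \<subseteq> {a..b}" for c d
    using that has_vector_derivative_continuous[OF der]
    by (intro continuous_at_imp_continuous_on) auto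
  consider "t = t0" | "t0 < t" | "t < t0" by linarith
  then show ?thesis
  proof cases
    case 2
    let ?p = "\<lambda>s. C * (M * (s - t0)) ^ Suc n / fact (Suc n)"
    have "norm (f t - f t0) \<le> ?p t - ?p t0"
    proof (rule differentiable_bound_general[OF 2])
      show "continuous_on {t0..t} f" using t t0 by (intro cont) auto
      show "(f has_vector_derivative f' s) (at s)" if "t0 < s" "s < t" for s
        using that t t0 by (intro der) auto
      show "(?p has_vector_derivative M * (C * (M * (s - t0)) ^ n / fact n)) (at s)" for s
        unfolding has_real_derivative_iff_has_vector_derivative[symmetric]
        by (auto intro!: derivative_eq_intros simp: field_simps simp del: power_Suc of_nat_Suc)
      show "norm (f' s) \<le> M * (C * (M * (s - t0)) ^ n / fact n)" if "t0 < s" "s < t" for s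
        using bnd[of s] that t t0 by auto
    qed (intro continuous_intros; simp)
    then show ?thesis using 2 t0 by simp
  next
    case 3
    let ?p = "\<lambda>s. - (C * (M * (t0 - s)) ^ Suc n / fact (Suc n))"
    have "norm (f t0 - f t) \<le> ?p t0 - ?p t"
    proof (rule differentiable_bound_general[OF 3])
      show "continuous_on {t..t0} f" using t t0 by (intro cont) auto
      show "(f has_vector_derivative f' s) (at s)" if "t < s" "s < t0" for s
        using that t t0 by (intro der) auto
      show "(?p has_vector_derivative M * (C * (M * (t0 - s)) ^ n / fact n)) (at s)" for s
        unfolding has_real_derivative_iff_has_vector_derivative[symmetric]
        by (auto intro!: derivative_eq_intros simp: field_simps simp del: power_Suc of_nat_Suc)
      show "norm (f' s) \<le> M * (C * (M * (t0 - s)) ^ n / fact n)" if "t < s" "s < t0" for s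
        using bnd[of s] that t t0 by auto
    qed (intro continuous_intros; simp)
    then show ?thesis using 3 t0 by simp
  qed (use t0 in simp)
qed

text \<open>
  The equation \<open>U' = p U K\<close> is solved by the sum \<open>U = u\<^sub>0 + u\<^sub>1 + \<dots>\<close>, where \<open>u\<^sub>0\<close> is the
  constant initial value and \<open>u\<^sub>n\<^sub>+\<^sub>1\<close> is the antiderivative of \<open>p u\<^sub>n K\<close> that vanishes at \<open>t0\<close>. On a
  compact subinterval the terms are dominated by an exponential series, so the series and the
  series of derivatives converge uniformly there. Linearity is what makes the solution exist on
  all of \<open>I\<close>.
\<close>

lemma linear_ode_exists:
  fixes p :: "'a::banach \<Rightarrow> 'b::real_normed_vector \<Rightarrow> 'a" and K :: "real \<Rightarrow> 'b"
  assumes p: "bounded_bilinear p"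
    and I: "open I" "is_interval I" and t0: "t0 \<in> I" and K: "continuous_on I K"
  obtains U where "U t0 = u0" "\<And>t. t \<in> I \<Longrightarrow> (U has_vector_derivative p (U t) (K t)) (at t)"
proof -
  interpret p: bounded_bilinear p by (rule p)
  have "\<exists>G. continuous_on I g \<longrightarrow> G t0 = 0 \<and> (\<forall>t\<in>I. (G has_vector_derivative g t) (at t))"
    for g :: "real \<Rightarrow> 'a"
    using antiderivative_on_open_interval[OF I t0] by metis
  then obtain anti :: "(real \<Rightarrow> 'a) \<Rightarrow> real \<Rightarrow> 'a" where
    anti: "\<And>g. continuous_on I g \<Longrightarrow> anti g t0 = 0"
      "\<And>g t. continuous_on I g \<Longrightarrow> t \<in> I \<Longrightarrow> (anti g has_vector_derivative g t) (at t)"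
    by metis
  \<comment> \<open>The terms of the Picard series; \<open>u' n\<close> below is the derivative of \<open>u n\<close>.\<close>
  define u where "u = rec_nat (\<lambda>_. u0) (\<lambda>_ v. anti (\<lambda>t. p (v t) (K t)))"
  have u_0: "u 0 = (\<lambda>_. u0)" and u_Suc: "u (Suc n) = anti (\<lambda>t. p (u n t) (K t))" for n
    by (simp_all add: u_def)
  have cont: "continuous_on I (u n)" for n
  proof (induction n)
    case (Suc n)
    then have "continuous_on I (\<lambda>t. p (u n t) (K t))"
      by (intro p.continuous_on K)
    then show ?case
      unfolding u_Suc
      using has_vector_derivative_continuous[OF anti(2)] by (intro continuous_at_imp_continuous_on) blast
  qed (simp add: u_0)
  then have cont': "continuous_on I (\<lambda>t. p (u n t) (K t))" for n
    by (intro p.continuous_on K)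
  define u' where "u' n t = (case n of 0 \<Rightarrow> 0 | Suc m \<Rightarrow> p (u m t) (K t))" for n t
  have u': "(u n has_vector_derivative u' n t) (at t)" if "t \<in> I" for n t
    using anti(2)[OF cont'] that by (cases n) (auto simp: u_0 u_Suc u'_def)
  have u_t0: "u (Suc n) t0 = 0" for n
    using anti(1)[OF cont'] by (simp add: u_Suc)
  define U where "U t = (\<Sum>n. u n t)" for t
  have "U t0 = u0"
  proof -
    have "(\<lambda>n. u n t0) sums (\<Sum>n\<in>{0}. u n t0)"
    proof (rule sums_finite)
      fix n assume "n \<notin> {0::nat}"
      then show "u n t0 = 0" by (cases n) (auto simp: u_t0)
    qed simp
    then show ?thesis by (simp add: U_def u_0 sums_iff)
  qed
  moreover have "(U has_vector_derivative p (U t) (K t)) (at t)" if t: "t \<in> I" for t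
  proof -
    from open_interval_enlarge[OF I t0 t] obtain a b
      where ab: "a < t0" "a < t" "t0 < b" "t < b" "{a..b} \<subseteq> I" by blast
    obtain B where B: "B > 0" "\<And>x y. norm (p x y) \<le> norm x * norm y * B"
      using p.pos_bounded by blast
    have "bounded (K ` {a..b})"
      by (intro compact_imp_bounded compact_continuous_image continuous_on_subset[OF K ab(5)]) auto
    then obtain k where k: "k > 0" "\<And>s. s \<in> {a..b} \<Longrightarrow> norm (K s) \<le> k"
      by (auto simp: bounded_pos)
    define M where "M = B * k"
    have M: "M > 0" using B k by (simp add: M_def)
    have pK: "norm (p x (K s)) \<le> M * norm x" if "s \<in> {a..b}" for x s
    proof -
      have "norm (p x (K s)) \<le> norm x * norm (K s) * B" by (rule B)
      also have "\<dots> \<le> norm x * k * B"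
        using k(2)[OF that] B(1) by (intro mult_right_mono mult_left_mono) auto
      finally show ?thesis by (simp add: M_def ac_simps)
    qed
    have bnd: "norm (u n s) \<le> norm u0 * (M * \<bar>s - t0\<bar>) ^ n / fact n" if "s \<in> {a..b}" for n s
      using that
    proof (induction n arbitrary: s)
      case (Suc n)
      have "norm (u' (Suc n) r) \<le> M * (norm u0 * (M * \<bar>r - t0\<bar>) ^ n / fact n)"
        if "r \<in> {a..b}" for r
      proof -
        have "norm (u' (Suc n) r) \<le> M * norm (u n r)"
          by (simp add: u'_def pK[OF that])
        also have "\<dots> \<le> M * (norm u0 * (M * \<bar>r - t0\<bar>) ^ n / fact n)"
          using Suc.IH[OF that] M by (intro mult_left_mono) auto
        finally show ?thesis .
      qed
      then show ?case
        using ab u_t0 Suc.prems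
        by (intro picard_step_bound[of a b "u (Suc n)" "u' (Suc n)"] u') auto
    qed (simp add: u_0)
    define c where "c n = norm u0 * ((M * (b - a)) ^ n / fact n)" for n
    have uc: "norm (u n s) \<le> c n" if "s \<in> {a..b}" for n s
    proof -
      have "norm (u n s) \<le> norm u0 * (M * \<bar>s - t0\<bar>) ^ n / fact n" by (rule bnd[OF that])
      also have "\<dots> \<le> norm u0 * (M * (b - a)) ^ n / fact n"
        using that ab M by (intro divide_right_mono mult_left_mono power_mono) auto
      finally show ?thesis by (simp add: c_def)
    qed
    have "summable (\<lambda>n. (M * (b - a)) ^ n / fact n)"
      using summable_exp[of "M * (b - a)"] by (simp add: divide_inverse mult.commute)
    then have c: "summable c" unfolding c_def by (rule summable_mult)
    have lim: "uniform_limit {a..b} (\<lambda>n s. \<Sum>i<n. u i s) U sequentially"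
      unfolding U_def using uc c by (intro Weierstrass_m_test) auto
    have sums: "(\<lambda>n. u n s) sums U s" if "s \<in> {a..b}" for s
    proof -
      have "summable (\<lambda>n. u n s)"
        by (rule summable_comparison_test'[OF c uc[OF that]])
      then show ?thesis unfolding U_def by (rule summable_sums)
    qed
    have "\<exists>g. \<forall>s\<in>{a<..<b}. (\<lambda>n. u n s) sums g s \<and>
        (g has_derivative (\<lambda>h. h *\<^sub>R p (U s) (K s))) (at s within {a<..<b})"
    proof (rule has_derivative_series[where f = u and f' = "\<lambda>n s h. h *\<^sub>R u' n s" and x = t and l = "U t"])
      fix n s assume "s \<in> {a<..<b}"
      then show "(u n has_derivative (\<lambda>h. h *\<^sub>R u' n s)) (at s within {a<..<b})"
        using u'[of s n] ab unfolding has_vector_derivative_def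
        by (metis (no_types, lifting) has_derivative_at_withinI atLeastAtMost_iff
            greaterThanLessThan_iff less_imp_le subsetD)
    next
      fix e :: real assume e: "e > 0"
      then have "\<forall>\<^sub>F n in sequentially. \<forall>s\<in>{a..b}. dist (\<Sum>i<n. u i s) (U s) < e / M"
        using lim M by (simp add: uniform_limit_iff)
      \<comment> \<open>Shifting by one: the derivatives of the first \<open>n + 1\<close> terms sum to \<open>p\<close> of the sum of the first \<open>n\<close> terms.\<close>
      then have *: "\<forall>\<^sub>F n in sequentially. \<forall>s\<in>{a<..<b}. \<forall>h.
        norm ((\<Sum>i<Suc n. h *\<^sub>R u' i s) - h *\<^sub>R p (U s) (K s)) \<le> e * norm h"
      proof (eventually_elim, intro ballI allI)
        fix n s h
        assume *: "\<forall>s\<in>{a..b}. dist (\<Sum>i<n. u i s) (U s) < e / M" and s: "s \<in> {a<..<b}"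
        have "(\<Sum>i<Suc n. h *\<^sub>R u' i s) = h *\<^sub>R p (\<Sum>i<n. u i s) (K s)"
          by (subst sum.lessThan_Suc_shift) (simp add: u'_def p.sum_left scaleR_sum_right)
        then have "norm ((\<Sum>i<Suc n. h *\<^sub>R u' i s) - h *\<^sub>R p (U s) (K s)) =
            \<bar>h\<bar> * norm (p ((\<Sum>i<n. u i s) - U s) (K s))"
          by (simp add: p.diff_left flip: scaleR_diff_right)
        also have "\<dots> \<le> \<bar>h\<bar> * (M * norm ((\<Sum>i<n. u i s) - U s))"
          using s by (intro mult_left_mono pK) auto
        also have "\<dots> \<le> \<bar>h\<bar> * (M * (e / M))"
          using s * M by (intro mult_left_mono) (auto simp: dist_norm less_imp_le)
        finally show "norm ((\<Sum>i<Suc n. h *\<^sub>R u' i s) - h *\<^sub>R p (U s) (K s)) \<le> e * norm h"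
          using M by (simp add: mult.commute)
      qed
      then show "\<forall>\<^sub>F n in sequentially. \<forall>s\<in>{a<..<b}. \<forall>h.
        norm ((\<Sum>i<n. h *\<^sub>R u' i s) - h *\<^sub>R p (U s) (K s)) \<le> e * norm h"
        by (subst (asm) eventually_sequentially_Suc)
    qed (use sums ab in auto)
    moreover have tab: "t \<in> {a<..<b}" using ab by simp
    ultimately obtain g where g: "\<And>s. s \<in> {a<..<b} \<Longrightarrow> (\<lambda>n. u n s) sums g s"
        "(g has_derivative (\<lambda>h. h *\<^sub>R p (U t) (K t))) (at t within {a<..<b})"
      using tab by blast
    then have "(g has_vector_derivative p (U t) (K t)) (at t)"
      using ab by (simp add: has_vector_derivative_def at_within_open[of t "{a<..<b}"])
    moreover have "g s = U s" if "s \<in> {a<..<b}" for s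
      using g(1)[OF that] sums[of s] that by (auto intro: sums_unique2)
    ultimately show ?thesis
      using tab has_vector_derivative_transform_within_open[of g _ t "{a<..<b}" U]
        open_greaterThanLessThan by blast
  qed
  ultimately show thesis using that by blast
qed

section \<open>Change of frame\<close>

lemma orthogonal_matrix_rows:
  fixes R :: "real^'n^'n"
  assumes "orthogonal_matrix R"
  shows "(\<Sum>k\<in>UNIV. R $ i $ k * R $ j $ k) = (if i = j then 1 else 0)"
proof -
  have "(R ** transpose R) $ i $ j = (if i = j then 1 else 0)"
    using assms by (simp add: orthogonal_matrix_def mat_def)
  then show ?thesis by (simp add: matrix_matrix_mult_def transpose_def)
qed

lemma orthogonal_matrix_columns:
  fixes R :: "real^'n^'n"
  assumes "orthogonal_matrix R"
  shows "(\<Sum>k\<in>UNIV. R $ k $ i * R $ k $ j) = (if i = j then 1 else 0)"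
proof -
  have "(transpose R ** R) $ i $ j = (if i = j then 1 else 0)"
    using assms by (simp add: orthogonal_matrix_def mat_def)
  then show ?thesis by (simp add: matrix_matrix_mult_def transpose_def)
qed

lemma lorentz_inner_matrix_mult:
  fixes R Z :: "real^4^4"
  shows "lorentz_inner ((R ** Z) $ i) ((R ** Z) $ j) =
     (\<Sum>k\<in>UNIV. \<Sum>l\<in>UNIV. R $ i $ k * R $ j $ l * lorentz_inner (Z $ k) (Z $ l))"
  by (simp add: lorentz_inner_def matrix_matrix_mult_def sum_4 algebra_simps)

lemma lorentz_inner_commute: "lorentz_inner v w = lorentz_inner w v"
  by (simp add: lorentz_inner_def mult.commute)

text \<open>
  The first row of \<open>R\<close> keeps the tangent vector, and by orthogonality the first column of \<open>R\<close> is
  then that of the identity as well, so \<open>R\<close> rotates the normal vectors among themselves. The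
  equation for \<open>R'\<close> is the product rule for \<open>(R Z)' = R' Z + R X Z\<close>, rearranged.
\<close>

lemma gauge_transformation:
  assumes I: "open I" and Z: "orthonormal_frame I \<gamma> Z" "has_coefficient_matrix I Z X"
    and R: "smooth_on I R" "\<And>s. s \<in> I \<Longrightarrow> orthogonal_matrix (R s)"
      "\<And>s. s \<in> I \<Longrightarrow> R s $ 1 = axis 1 1"
    and R': "\<And>s. s \<in> I \<Longrightarrow> (R has_vector_derivative Y s ** R s - R s ** X s) (at s)"
  shows "orthonormal_frame I \<gamma> (\<lambda>s. R s ** Z s)" "has_coefficient_matrix I (\<lambda>s. R s ** Z s) Y"
proof -
  have "(R s ** Z s) $ 1 = vector_derivative \<gamma> (at s) \<and>
        (\<forall>i\<in>{2,3,4}. lorentz_inner ((R s ** Z s) $ 1) ((R s ** Z s) $ i) = 0) \<and>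
        (\<forall>i\<in>{2,3,4}. \<forall>j\<in>{2,3,4}.
          lorentz_inner ((R s ** Z s) $ i) ((R s ** Z s) $ j) = (if i = j then 1 else 0))"
    if s: "s \<in> I" for s
  proof (intro conjI ballI)
    have row1: "R s $ 1 $ j = (if j = 1 then 1 else 0)" for j
      by (simp add: R(3)[OF s] axis_def)
    have col1: "R s $ i $ 1 = (if i = 1 then 1 else 0)" for i
      using orthogonal_matrix_rows[OF R(2)[OF s], of i 1]
      by (simp add: row1 sum_4 cong: if_cong)
    have Z1: "Z s $ 1 = vector_derivative \<gamma> (at s)"
      using Z(1) s unfolding orthonormal_frame_def by blast
    have Z1i: "lorentz_inner (Z s $ 1) (Z s $ i) = 0" "lorentz_inner (Z s $ i) (Z s $ 1) = 0"
      if "i \<in> {2,3,4}" for i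
      using Z(1) s that lorentz_inner_commute[of "Z s $ i" "Z s $ 1"]
      unfolding orthonormal_frame_def by auto
    have Zij: "lorentz_inner (Z s $ i) (Z s $ j) = (if i = j then 1 else 0)"
      if "i \<in> {2,3,4}" "j \<in> {2,3,4}" for i j
      using Z(1) s that unfolding orthonormal_frame_def by blast
    show "(R s ** Z s) $ 1 = vector_derivative \<gamma> (at s)"
      using Z1 by (simp add: vec_eq_iff matrix_matrix_mult_def sum_4 row1)
    fix i :: 4 assume i: "i \<in> {2,3,4}"
    then have i1: "i \<noteq> 1" by auto
    show "lorentz_inner ((R s ** Z s) $ 1) ((R s ** Z s) $ i) = 0"
      unfolding lorentz_inner_matrix_mult by (simp add: sum_4 row1 col1 i1 Z1i)
    fix j :: 4 assume j: "j \<in> {2,3,4}"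
    then have j1: "j \<noteq> 1" by auto
    show "lorentz_inner ((R s ** Z s) $ i) ((R s ** Z s) $ j) = (if i = j then 1 else 0)"
      using orthogonal_matrix_rows[OF R(2)[OF s], of i j]
      unfolding lorentz_inner_matrix_mult by (simp add: sum_4 row1 col1 i1 j1 Z1i Zij)
  qed
  moreover have "smooth_on I (\<lambda>s. R s ** Z s)"
    using Z(1) unfolding orthonormal_frame_def by (intro smooth_on_matrix_mult I R) auto
  ultimately show "orthonormal_frame I \<gamma> (\<lambda>s. R s ** Z s)"
    unfolding orthonormal_frame_def by blast
  show "has_coefficient_matrix I (\<lambda>s. R s ** Z s) Y"
    unfolding has_coefficient_matrix_def
  proof
    fix s assume s: "s \<in> I"
    have "((\<lambda>s. R s ** Z s) has_vector_derivative
        R s ** (X s ** Z s) + (Y s ** R s - R s ** X s) ** Z s) (at s)"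
      using Z(2) s R'[OF s] unfolding has_coefficient_matrix_def
      by (intro bounded_bilinear.has_vector_derivative[OF bounded_bilinear_matrix_mult]) auto
    also have "R s ** (X s ** Z s) + (Y s ** R s - R s ** X s) ** Z s = Y s ** (R s ** Z s)"
      by (simp add: bounded_bilinear.diff_left[OF bounded_bilinear_matrix_mult] matrix_mul_assoc)
    finally show "((\<lambda>s. R s ** Z s) has_vector_derivative Y s ** (R s ** Z s)) (at s)" .
  qed
qed

text \<open>
  Permuting the normal vectors of an orthonormal frame gives an orthonormal frame again, so the
  permutation in the definition can be absorbed into the frame.
\<close>

lemma admits_bishop_frame_iff:
  assumes I: "open I"
  shows "admits_bishop_frame form I \<gamma> \<longleftrightarrow>
    (\<exists>Z x1 x2 x3. orthonormal_frame I \<gamma> Z \<and> smooth_on I x1 \<and> smooth_on I x2 \<and> smooth_on I x3 \<and>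
       has_coefficient_matrix I Z (\<lambda>s. form (x1 s) (x2 s) (x3 s)))"
    (is "_ \<longleftrightarrow> ?rhs")
proof
  assume "admits_bishop_frame form I \<gamma>"
  then obtain Z \<pi> x1 x2 x3 where Z: "orthonormal_frame I \<gamma> Z" and \<pi>: "\<pi> permutes {2,3,4}"
    and x: "smooth_on I x1" "smooth_on I x2" "smooth_on I x3"
      "has_coefficient_matrix I (\<lambda>s. \<chi> i. Z s $ \<pi> i) (\<lambda>s. form (x1 s) (x2 s) (x3 s))"
    unfolding admits_bishop_frame_def generalized_bishop_frame_def by blast
  have \<pi>1: "\<pi> 1 = 1" by (rule permutes_not_in[OF \<pi>]) auto
  have \<pi>i: "\<pi> i \<in> {2,3,4} \<longleftrightarrow> i \<in> {2,3,4}" for i using permutes_in_image[OF \<pi>] .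
  have \<pi>e: "\<pi> i = \<pi> j \<longleftrightarrow> i = j" for i j using permutes_inj[OF \<pi>] by (auto dest: injD)
  have "smooth_on I (\<lambda>s. \<chi> i. Z s $ \<pi> i)"
    using Z unfolding orthonormal_frame_def
    by (intro smooth_on_vec_lambda smooth_on_vec_nth I) auto
  then have "orthonormal_frame I \<gamma> (\<lambda>s. \<chi> i. Z s $ \<pi> i)"
    unfolding orthonormal_frame_def vec_lambda_beta \<pi>1
  proof (intro conjI ballI)
    fix s i j assume s: "s \<in> I"
    show "Z s $ 1 = vector_derivative \<gamma> (at s)"
      using Z s unfolding orthonormal_frame_def by blast
    assume i: "i \<in> {2,3,4::4}"
    then have pi: "\<pi> i \<in> {2,3,4}" using \<pi>i by blast
    then show "lorentz_inner (Z s $ 1) (Z s $ \<pi> i) = 0"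
      using Z s unfolding orthonormal_frame_def by blast
    assume j: "j \<in> {2,3,4::4}"
    then have pj: "\<pi> j \<in> {2,3,4}" using \<pi>i by blast
    have "lorentz_inner (Z s $ \<pi> i) (Z s $ \<pi> j) = (if \<pi> i = \<pi> j then 1 else 0)"
      using Z s pi pj unfolding orthonormal_frame_def by blast
    then show "lorentz_inner (Z s $ \<pi> i) (Z s $ \<pi> j) = (if i = j then 1 else 0)"
      by (simp only: \<pi>e)
  qed
  then show ?rhs using x by blast
next
  assume ?rhs
  then obtain Z x1 x2 x3 where Z: "orthonormal_frame I \<gamma> Z"
    and x: "smooth_on I x1" "smooth_on I x2" "smooth_on I x3"
      "has_coefficient_matrix I (\<lambda>s. \<chi> i. Z s $ id i) (\<lambda>s. form (x1 s) (x2 s) (x3 s))"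
    by auto
  show "admits_bishop_frame form I \<gamma>"
    unfolding admits_bishop_frame_def generalized_bishop_frame_def
    using Z x permutes_id by blast
qed

lemma bounded_linear_transpose: "bounded_linear (transpose :: real^'n^'m \<Rightarrow> real^'m^'n)"
  by (auto simp: linear_conv_bounded_linear[symmetric] linear_iff transpose_def vec_eq_iff)

text \<open>
  Skew-symmetry of \<open>K\<close> makes \<open>R R\<^sup>T\<close> constant along solutions of \<open>R' = - R K\<close>. If row \<open>i\<close> of \<open>K\<close>
  vanishes, so does column \<open>i\<close>, hence column \<open>i\<close> of \<open>R\<close> is constant, and orthogonality passes
  this on to row \<open>i\<close>.
\<close>

lemma parallel_gauge:
  fixes K :: "real \<Rightarrow> real^'n^'n"
  assumes I: "open I" "is_interval I" and K: "smooth_on I K"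
    and skew: "\<And>s. s \<in> I \<Longrightarrow> transpose (K s) = - K s"
  obtains R where "smooth_on I R" "\<And>s. s \<in> I \<Longrightarrow> orthogonal_matrix (R s)"
    "\<And>s. s \<in> I \<Longrightarrow> (R has_vector_derivative - (R s ** K s)) (at s)"
    "\<And>s i. s \<in> I \<Longrightarrow> (\<And>t. t \<in> I \<Longrightarrow> K t $ i = 0) \<Longrightarrow>
       R s $ i = axis i 1 \<and> (\<forall>j. R s $ j $ i = (if j = i then 1 else 0))"
proof (cases "I = {}")
  case True
  then show thesis by (intro that[of "\<lambda>_. mat 1"]) (auto simp: smooth_on_def)
next
  case False
  then obtain t0 where t0: "t0 \<in> I" by blast
  note mm = bounded_bilinear_matrix_mult[where 'n='n and 'm='n and 'p='n]
  have "continuous_on I (\<lambda>s. - K s)"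
    by (intro continuous_on_minus smooth_on_continuous_on K)
  from linear_ode_exists[OF mm I t0 this, of "mat 1"]
  obtain R where R0: "R t0 = mat 1"
    and "\<And>s. s \<in> I \<Longrightarrow> (R has_vector_derivative R s ** - K s) (at s)" by blast
  then have R': "(R has_vector_derivative - (R s ** K s)) (at s)" if "s \<in> I" for s
    using that by (simp add: bounded_bilinear.minus_right[OF mm])
  have const: "f s = f t0"
    if "\<And>s. s \<in> I \<Longrightarrow> (f has_vector_derivative 0) (at s)" "s \<in> I"
    for f :: "real \<Rightarrow> 'c::real_normed_vector" and s
  proof -
    have "\<exists>c. \<forall>x\<in>I. f x = c"
      using has_vector_derivative_zero_constant[OF is_interval_convex[OF I(2)], of f]
        has_vector_derivative_at_within[OF that(1)] by metis
    then show ?thesis using that(2) t0 by metis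
  qed
  have orth: "orthogonal_matrix (R s)" if "s \<in> I" for s
  proof -
    have "R s ** transpose (R s) = R t0 ** transpose (R t0)"
    proof (rule const[OF _ that])
      fix s assume s: "s \<in> I"
      have "((\<lambda>s. R s ** transpose (R s)) has_vector_derivative
          R s ** transpose (- (R s ** K s)) + (- (R s ** K s)) ** transpose (R s)) (at s)"
        by (intro bounded_bilinear.has_vector_derivative[OF mm]
            bounded_linear.has_vector_derivative[OF bounded_linear_transpose] R' s)
      moreover have "transpose (- (R s ** K s)) = K s ** transpose (R s)"
        by (simp add: linear_neg[OF bounded_linear.linear[OF bounded_linear_transpose]] matrix_transpose_mul
            skew[OF s] bounded_bilinear.minus_left[OF mm])
      ultimately show "((\<lambda>s. R s ** transpose (R s)) has_vector_derivative 0) (at s)"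
        by (simp add: bounded_bilinear.minus_left[OF mm] matrix_mul_assoc)
    qed
    then have "R s ** transpose (R s) = mat 1" by (simp add: R0 transpose_mat)
    then show ?thesis
      unfolding orthogonal_matrix_def using matrix_left_right_inverse by blast
  qed
  show thesis
  proof
    show "smooth_on I R"
    proof (rule smooth_on_bootstrap[OF I(1) R'])
      fix n assume "times_differentiable_on n I R"
      then show "times_differentiable_on n I (\<lambda>s. - (R s ** K s))"
        using K unfolding smooth_on_iff_times_differentiable_on
        by (intro times_differentiable_on_linear[OF bounded_linear_minus[OF bounded_linear_ident]]
            times_differentiable_on_bilinear[OF mm] I(1)) auto
    qed
    fix s i assume s: "s \<in> I" and Ki: "\<And>t. t \<in> I \<Longrightarrow> K t $ i = 0"
    have col: "R s $ j $ i = (if j = i then 1 else 0)" for j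
    proof -
      have "R s $ j $ i = R t0 $ j $ i"
      proof (rule const[OF _ s])
        fix t assume t: "t \<in> I"
        have "K t $ k $ i = 0" for k
          using Ki[OF t] arg_cong[OF skew[OF t], of "\<lambda>A. A $ i $ k"] by (simp add: transpose_def)
        then have "(- (R t ** K t)) $ j $ i = 0"
          by (simp add: matrix_matrix_mult_def)
        moreover have "((\<lambda>s. R s $ j $ i) has_vector_derivative (- (R t ** K t)) $ j $ i) (at t)"
          by (intro bounded_linear.has_vector_derivative[OF bounded_linear_vec_nth] R' t)
        ultimately show "((\<lambda>s. R s $ j $ i) has_vector_derivative 0) (at t)" by simp
      qed
      then show ?thesis by (simp add: R0 mat_def)
    qed
    have "R s $ i $ j = (if i = j then 1 else 0)" for j
      using orthogonal_matrix_columns[OF orth[OF s], of i j]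
      by (simp add: col if_distrib[of "\<lambda>x. x * _"] cong: if_cong)
    then show "R s $ i = axis i 1 \<and> (\<forall>j. R s $ j $ i = (if j = i then 1 else 0))"
      using col by (auto simp: vec_eq_iff axis_def)
  qed (use orth R' in auto)
qed

section \<open>From type F to type D\<close>

lemma smooth_on_form_F:
  assumes "open I" "smooth_on I x1" "smooth_on I x2" "smooth_on I x3"
  shows "smooth_on I (\<lambda>s. form_F (x1 s) (x2 s) (x3 s))"
proof (rule smooth_on_matrix[OF assms(1)])
  have "\<forall>i j. smooth_on I (\<lambda>s. form_F (x1 s) (x2 s) (x3 s) $ i $ j)"
    unfolding forall_4 form_F_def vector_4 using assms
    by (intro conjI smooth_on_const smooth_on_minus)
  then show "smooth_on I (\<lambda>s. form_F (x1 s) (x2 s) (x3 s) $ i $ j)" for i j by blast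
qed

lemma smooth_on_form_D:
  assumes "open I" "smooth_on I x1" "smooth_on I x2" "smooth_on I x3"
  shows "smooth_on I (\<lambda>s. form_D (x1 s) (x2 s) (x3 s))"
proof (rule smooth_on_matrix[OF assms(1)])
  have "\<forall>i j. smooth_on I (\<lambda>s. form_D (x1 s) (x2 s) (x3 s) $ i $ j)"
    unfolding forall_4 form_D_def vector_4 using assms
    by (intro conjI smooth_on_const smooth_on_minus)
  then show "smooth_on I (\<lambda>s. form_D (x1 s) (x2 s) (x3 s) $ i $ j)" for i j by blast
qed

text \<open>
  Only the entries \<open>\<plusminus>x3\<close> are gauged away. Since \<open>R\<close> fixes \<open>T\<close> and \<open>Z\<^sub>1\<close>, what remains of the
  normal part is the entry \<open>x2\<close>, distributed over the two rotated vectors with the coordinates of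
  the old \<open>Z\<^sub>2\<close>, the third column of \<open>R\<close>.
\<close>

lemma admits_type_D_if_type_F:
  assumes I: "open I" "is_interval I" and F: "admits_bishop_frame form_F I \<gamma>"
  shows "admits_bishop_frame form_D I \<gamma>"
proof -
  obtain Z x1 x2 x3 where Z: "orthonormal_frame I \<gamma> Z"
      "has_coefficient_matrix I Z (\<lambda>s. form_F (x1 s) (x2 s) (x3 s))"
    and x: "smooth_on I x1" "smooth_on I x2" "smooth_on I x3"
    using F unfolding admits_bishop_frame_iff[OF I(1)] by blast
  define K where "K s = form_F 0 0 (x3 s)" for s
  have K: "smooth_on I K"
    unfolding K_def by (intro smooth_on_form_F smooth_on_const x I)
  have skew: "transpose (K s) = - K s" for s
    by (simp add: K_def form_F_def transpose_def vec_eq_iff forall_4 vector_4)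
  have K0: "K s $ 1 = 0" "K s $ 2 = 0" for s
    by (simp_all add: K_def form_F_def vec_eq_iff forall_4 vector_4)
  obtain R where R: "smooth_on I R" "\<And>s. s \<in> I \<Longrightarrow> orthogonal_matrix (R s)"
    "\<And>s. s \<in> I \<Longrightarrow> (R has_vector_derivative - (R s ** K s)) (at s)"
    and R_fix: "\<And>s i. s \<in> I \<Longrightarrow> (\<And>t. t \<in> I \<Longrightarrow> K t $ i = 0) \<Longrightarrow>
       R s $ i = axis i 1 \<and> (\<forall>j. R s $ j $ i = (if j = i then 1 else 0))"
    using parallel_gauge[OF I K skew] by blast
  define y2 where "y2 s = x2 s * R s $ 3 $ 3" for s
  define y3 where "y3 s = x2 s * R s $ 4 $ 3" for s
  have y: "smooth_on I y2" "smooth_on I y3"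
    unfolding y2_def y3_def by (intro smooth_on_mult smooth_on_vec_nth R x I)+
  have R': "(R has_vector_derivative form_D (x1 s) (y2 s) (y3 s) ** R s -
      R s ** form_F (x1 s) (x2 s) (x3 s)) (at s)" if s: "s \<in> I" for s
  proof -
    have fixed: "R s $ 1 = axis 1 1" "R s $ 2 = axis 2 1"
      "R s $ 3 $ 1 = 0" "R s $ 3 $ 2 = 0" "R s $ 4 $ 1 = 0" "R s $ 4 $ 2 = 0"
      using R_fix[OF s, of 1] R_fix[OF s, of 2] K0 by auto
    have orth: "R s $ 3 $ 3 * R s $ 3 $ 3 + R s $ 4 $ 3 * R s $ 4 $ 3 = 1"
      "R s $ 3 $ 3 * R s $ 3 $ 4 + R s $ 4 $ 3 * R s $ 4 $ 4 = 0"
      using orthogonal_matrix_columns[OF R(2)[OF s], of 3 3]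
        orthogonal_matrix_columns[OF R(2)[OF s], of 3 4]
      by (simp_all add: sum_4 fixed axis_def)
    have "x2 s * R s $ 3 $ 3 * R s $ 3 $ 3 + x2 s * R s $ 4 $ 3 * R s $ 4 $ 3 = x2 s"
      "x2 s * R s $ 3 $ 3 * R s $ 3 $ 4 + x2 s * R s $ 4 $ 3 * R s $ 4 $ 4 = 0"
      using orth by algebra+
    then have "form_D (x1 s) (y2 s) (y3 s) ** R s - R s ** form_F (x1 s) (x2 s) (x3 s) =
        - (R s ** K s)"
      by (simp add: vec_eq_iff forall_4 matrix_matrix_mult_def sum_4 form_D_def form_F_def K_def
          vector_4 fixed axis_def y2_def y3_def)
    then show ?thesis using R(3)[OF s] by simp
  qed
  have R1: "R s $ 1 = axis 1 1" if "s \<in> I" for s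
    using R_fix[OF that, of 1] K0 by blast
  note gauge = gauge_transformation[OF I(1) Z R(1,2) R1 R']
  show ?thesis
    unfolding admits_bishop_frame_iff[OF I(1)] using gauge x y by blast
qed

section \<open>From type D to type C\<close>

text \<open>
  The coefficient matrix of Bishop's frame, whose normal vectors are parallel in the normal bundle:
  each of them has a tangential derivative.
\<close>

definition form_B :: "real \<Rightarrow> real \<Rightarrow> real \<Rightarrow> real^4^4" where
  "form_B x1 x2 x3 = vector
     [vector [ 0, x1, x2, x3],
      vector [x1,  0,  0,  0],
      vector [x2,  0,  0,  0],
      vector [x3,  0,  0,  0]]"

text \<open>
  The points \<open>z e\<^sub>1 + r n(s)\<close> form the differentiable image of a three-dimensional set in
  \<open>\<real>\<^sup>4\<close>, which is negligible. Normalizing the part orthogonal to \<open>e\<^sub>1\<close> of any point outside gives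
  \<open>c\<close>. Working with the cone over \<open>n\<close>, extended in the direction of \<open>e\<^sub>1\<close>, replaces an argument
  about measure zero on the sphere.
\<close>

lemma exists_unit_vector_avoiding_curve:
  fixes n :: "real \<Rightarrow> real^4"
  assumes n: "\<And>s. s \<in> I \<Longrightarrow> n differentiable at s" and ne: "I \<noteq> {}"
  obtains c where "norm c = 1" "c $ 1 = 0" "\<And>s m. s \<in> I \<Longrightarrow> c \<noteq> m *\<^sub>R n s"
proof -
  define f :: "real \<times> real \<times> real \<Rightarrow> real^4"
    where "f = (\<lambda>x. fst x *\<^sub>R axis 1 1 + fst (snd x) *\<^sub>R n (snd (snd x)))"
  have "f differentiable_on UNIV \<times> UNIV \<times> I"
    unfolding differentiable_on_def
  proof
    fix x assume x: "x \<in> (UNIV \<times> UNIV \<times> I :: (real \<times> real \<times> real) set)"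
    have proj: "(\<lambda>x. snd (snd x)) differentiable at x" "(\<lambda>x. fst (snd x)) differentiable at x"
        "fst differentiable at x"
      by (intro bounded_linear_imp_differentiable bounded_linear_fst_comp bounded_linear_snd_comp
          bounded_linear_fst bounded_linear_snd bounded_linear_ident)+
    have "n differentiable at (snd (snd x))" using x n by auto
    then have "(n \<circ> (\<lambda>x. snd (snd x))) differentiable at x"
      by (rule differentiable_chain_at[OF proj(1)])
    then have "f differentiable at x"
      unfolding f_def o_def
      by (intro differentiable_add differentiable_scaleR proj differentiable_const)
    then show "f differentiable at x within UNIV \<times> UNIV \<times> I"
      by (rule differentiable_at_withinI)
  qed
  then have "negligible (f ` (UNIV \<times> UNIV \<times> I))"
    by (intro negligible_differentiable_image_lowdim) simp_all
  then obtain v where v: "v \<notin> f ` (UNIV \<times> UNIV \<times> I)"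
    using non_negligible_UNIV by (metis UNIV_eq_I)
  define w where "w = v - v $ 1 *\<^sub>R axis 1 1"
  have v_eq: "v = v $ 1 *\<^sub>R axis 1 1 + w" by (simp add: w_def)
  have avoid: "w \<noteq> r *\<^sub>R n s" if "s \<in> I" for r s
  proof
    assume "w = r *\<^sub>R n s"
    then have "v = f (v $ 1, r, s)" using v_eq by (simp add: f_def)
    then show False using v that by blast
  qed
  then have w0: "w \<noteq> 0" using ne by (metis ex_in_conv scaleR_zero_left)
  show thesis
  proof
    show "norm (w /\<^sub>R norm w) = 1" using w0 by simp
    show "(w /\<^sub>R norm w) $ 1 = 0" by (simp add: w_def axis_def)
    fix s m assume s: "s \<in> I"
    show "w /\<^sub>R norm w \<noteq> m *\<^sub>R n s"
    proof
      assume "w /\<^sub>R norm w = m *\<^sub>R n s"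
      then have "norm w *\<^sub>R (w /\<^sub>R norm w) = (norm w * m) *\<^sub>R n s" by simp
      then show False using w0 avoid[OF s, of "norm w * m"] by simp
    qed
  qed
qed

text \<open>
  The reflection that exchanges \<open>c\<close> and \<open>e\<^sub>4\<close> fixes \<open>e\<^sub>1\<close>, which is orthogonal to both.
\<close>

lemma exists_orthogonal_matrix_to_axis:
  fixes c :: "real^4"
  assumes c: "norm c = 1" "c $ 1 = 0"
  obtains Q where "orthogonal_matrix Q" "Q $ 1 = axis 1 1" "Q *v c = axis 4 1"
proof -
  define w where "w = c - axis 4 1"
  \<comment> \<open>For \<open>c = e\<^sub>4\<close> the division by zero gives \<open>k = 0\<close>, and the reflection becomes the identity, as it should.\<close>
  define k where "k = 2 / (w \<bullet> w)"
  define f where "f x = x - (k * (w \<bullet> x)) *\<^sub>R w" for x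
  have kk: "k * k * (w \<bullet> w) = 2 * k" by (simp add: k_def)
  have f: "orthogonal_transformation f"
    unfolding orthogonal_transformation_def
  proof (intro conjI allI)
    show "linear f"
      by (auto simp: linear_iff f_def inner_add_right algebra_simps)
    fix x y
    have "f x \<bullet> f y = x \<bullet> y - 2 * k * (w \<bullet> x) * (w \<bullet> y) + (k * k * (w \<bullet> w)) * (w \<bullet> x) * (w \<bullet> y)"
      by (simp add: f_def inner_diff_left inner_diff_right inner_commute algebra_simps)
    then show "f x \<bullet> f y = x \<bullet> y" by (simp add: kk)
  qed
  then have lin: "linear f" and orth: "orthogonal_matrix (matrix f)"
    by (simp_all add: orthogonal_transformation_matrix)
  show thesis
  proof
    show "orthogonal_matrix (matrix f)" by (rule orth)
    show "matrix f $ 1 = axis 1 1"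
      using c by (simp add: vec_eq_iff matrix_def f_def w_def axis_def)
    have "c \<bullet> c = 1" using c by (simp add: dot_square_norm)
    then have "w \<bullet> w = 2 * (w \<bullet> c)"
      by (simp add: w_def inner_diff_left inner_diff_right inner_commute inner_axis_axis
          algebra_simps)
    then have "f c = axis 4 1"
      by (cases "w = 0") (auto simp: f_def k_def, simp_all add: w_def)
    then show "matrix f *v c = axis 4 1"
      by (simp add: matrix_works[OF lin[unfolded linear_matrix_vector_mul_eq[symmetric]]])
  qed
qed

text \<open>
  The whole normal block of the coefficient matrix is gauged away by \<open>P\<close>. The old vector \<open>Z\<^sub>1\<close>,
  along which \<open>T'\<close> points, has the second column of \<open>P\<close> as its coordinates in the parallel frame.
  The constant rotation \<open>Q\<close> keeps the frame parallel and keeps this column off the last axis.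
\<close>

lemma parallel_frame_if_type_D:
  assumes I: "open I" "is_interval I" and D: "admits_bishop_frame form_D I \<gamma>"
  obtains Z x n2 n3 n4 where "orthonormal_frame I \<gamma> Z"
    "smooth_on I x" "smooth_on I n2" "smooth_on I n3" "smooth_on I n4"
    "\<forall>s\<in>I. n2 s \<noteq> 0 \<or> n3 s \<noteq> 0"
    "has_coefficient_matrix I Z (\<lambda>s. form_B (x s * n2 s) (x s * n3 s) (x s * n4 s))"
proof -
  obtain Z x1 x2 x3 where Z: "orthonormal_frame I \<gamma> Z"
      "has_coefficient_matrix I Z (\<lambda>s. form_D (x1 s) (x2 s) (x3 s))"
    and x: "smooth_on I x1" "smooth_on I x2" "smooth_on I x3"
    using D unfolding admits_bishop_frame_iff[OF I(1)] by blast
  define K where "K s = form_D 0 (x2 s) (x3 s)" for s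
  have K: "smooth_on I K"
    unfolding K_def by (intro smooth_on_form_D smooth_on_const x I)
  have skew: "transpose (K s) = - K s" for s
    by (simp add: K_def form_D_def transpose_def vec_eq_iff forall_4 vector_4)
  have K0: "K s $ 1 = 0" for s
    by (simp add: K_def form_D_def vec_eq_iff forall_4 vector_4)
  obtain P where P: "smooth_on I P" "\<And>s. s \<in> I \<Longrightarrow> orthogonal_matrix (P s)"
    "\<And>s. s \<in> I \<Longrightarrow> (P has_vector_derivative - (P s ** K s)) (at s)"
    and P1: "\<And>s. s \<in> I \<Longrightarrow> P s $ 1 = axis 1 1"
    using parallel_gauge[OF I K skew] K0 by metis
  have "\<exists>c. norm c = 1 \<and> c $ 1 = 0 \<and> (\<forall>s\<in>I. \<forall>m. c \<noteq> m *\<^sub>R column 2 (P s))"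
  proof (cases "I = {}")
    case True
    moreover have "(axis 2 1 :: real^4) $ 1 = 0" by (simp add: axis_def)
    ultimately show ?thesis by (intro exI[of _ "axis 2 1"]) (simp add: norm_axis_1)
  next
    case False
    have "smooth_on I (\<lambda>s. column 2 (P s))"
      unfolding column_def by (intro smooth_on_vec_lambda smooth_on_vec_nth P I)
    then have "(\<lambda>s. column 2 (P s)) differentiable at s" if "s \<in> I" for s
      using that by (intro differentiableI_vector[OF smooth_on_has_vector_derivative])
    from exists_unit_vector_avoiding_curve[OF this False] show ?thesis by metis
  qed
  then obtain c where c: "norm c = 1" "c $ 1 = 0"
    and avoid: "\<And>s m. s \<in> I \<Longrightarrow> c \<noteq> m *\<^sub>R column 2 (P s)" by blast
  obtain Q where Q: "orthogonal_matrix Q" "Q $ 1 = axis 1 1" "Q *v c = axis 4 1"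
    using exists_orthogonal_matrix_to_axis[OF c] .
  define R where "R s = Q ** P s" for s
  define n where "n i s = R s $ i $ 2" for i s
  have R: "smooth_on I R"
    unfolding R_def by (intro smooth_on_matrix_mult smooth_on_const P I)
  have orth: "orthogonal_matrix (R s)" if "s \<in> I" for s
    unfolding R_def by (intro orthogonal_matrix_mul Q P that)
  have R1: "R s $ 1 = axis 1 1" if "s \<in> I" for s
    using P1[OF that] Q(2) by (simp add: R_def vec_eq_iff matrix_matrix_mult_def sum_4 axis_def)
  have R_col1: "R s $ i $ 1 = (if i = 1 then 1 else 0)" if "s \<in> I" for s i
    using orthogonal_matrix_rows[OF orth[OF that], of i 1] by (simp add: R1[OF that] sum_4 axis_def)
  have R': "(R has_vector_derivative - (R s ** K s)) (at s)" if s: "s \<in> I" for s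
  proof -
    have "bounded_linear (\<lambda>A. Q ** A)"
      by (rule bounded_bilinear.bounded_linear_right[OF bounded_bilinear_matrix_mult])
    from bounded_linear.has_vector_derivative[OF this P(3)[OF s]]
    show ?thesis
      by (simp add: R_def[abs_def] bounded_bilinear.minus_right[OF bounded_bilinear_matrix_mult]
          matrix_mul_assoc)
  qed
  have n_smooth: "smooth_on I (n i)" for i
    unfolding n_def by (intro smooth_on_vec_nth R I)
  have n_nz: "n 2 s \<noteq> 0 \<or> n 3 s \<noteq> 0" if s: "s \<in> I" for s
  proof (rule ccontr)
    assume "\<not> ?thesis"
    then have n23: "n 2 s = 0" "n 3 s = 0" by auto
    have n1: "n 1 s = 0" by (simp add: n_def R1[OF s] axis_def)
    have n4: "n 4 s * n 4 s = 1"
      using orthogonal_matrix_columns[OF orth[OF s], of 2 2] n1 n23 by (simp add: n_def sum_4)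
    have "Q *v column 2 (P s) = column 2 (R s)"
      by (simp add: R_def vec_eq_iff column_def matrix_matrix_mult_def matrix_vector_mult_def)
    also have "\<dots> = n 4 s *\<^sub>R axis 4 1"
      using n1 n23 by (simp add: vec_eq_iff forall_4 column_def n_def axis_def)
    finally have "n 4 s *\<^sub>R (Q *v column 2 (P s)) = (n 4 s * n 4 s) *\<^sub>R axis 4 1" by simp
    then have "Q *v (n 4 s *\<^sub>R column 2 (P s)) = Q *v c"
      using n4 Q(3) by (simp add: matrix_vector_mult_scaleR)
    then have "transpose Q *v (Q *v (n 4 s *\<^sub>R column 2 (P s))) = transpose Q *v (Q *v c)" by simp
    then have "n 4 s *\<^sub>R column 2 (P s) = c"
      using Q(1) by (simp add: matrix_vector_mul_assoc orthogonal_matrix_def)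
    then show False using avoid[OF s] by blast
  qed
  have R'': "(R has_vector_derivative
      form_B (x1 s * n 2 s) (x1 s * n 3 s) (x1 s * n 4 s) ** R s -
      R s ** form_D (x1 s) (x2 s) (x3 s)) (at s)" if s: "s \<in> I" for s
  proof -
    have "x1 s * (n 2 s * R s $ 2 $ j + n 3 s * R s $ 3 $ j + n 4 s * R s $ 4 $ j) =
        x1 s * (if j = 2 then 1 else 0)" if "j \<noteq> 1" for j
      using orthogonal_matrix_columns[OF orth[OF s], of 2 j] that
      by (simp add: sum_4 n_def R1[OF s] axis_def split: if_splits)
    note col = this[of 2] this[of 3] this[of 4]
    have "form_B (x1 s * n 2 s) (x1 s * n 3 s) (x1 s * n 4 s) ** R s -
        R s ** form_D (x1 s) (x2 s) (x3 s) = - (R s ** K s)"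
      using col by (simp add: vec_eq_iff forall_4 matrix_matrix_mult_def sum_4 form_B_def form_D_def
          K_def vector_4 R1[OF s] R_col1[OF s] axis_def n_def algebra_simps)
    then show ?thesis using R'[OF s] by simp
  qed
  note gauge = gauge_transformation[OF I(1) Z R orth R1 R'']
  show thesis
    using that[OF gauge(1) x(1) n_smooth n_smooth n_smooth _ gauge(2)] n_nz by blast
qed

text \<open>
  In the parallel frame, \<open>W\<^sub>1 = p N\<^sub>2 + r N\<^sub>3\<close> is the normalized projection of the direction of
  \<open>T'\<close> to the plane of \<open>N\<^sub>2\<close> and \<open>N\<^sub>3\<close>. The function \<open>y3\<close> is the angular velocity of \<open>(p, r)\<close>.
\<close>

lemma admits_type_C_if_type_D:
  assumes I: "open I" "is_interval I" and D: "admits_bishop_frame form_D I \<gamma>"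
  shows "admits_bishop_frame form_C I \<gamma>"
proof -
  obtain Z x n2 n3 n4 where Z1: "orthonormal_frame I \<gamma> Z"
    and sm: "smooth_on I x" "smooth_on I n2" "smooth_on I n3" "smooth_on I n4"
    and nz: "\<forall>s\<in>I. n2 s \<noteq> 0 \<or> n3 s \<noteq> 0"
    and Z2: "has_coefficient_matrix I Z (\<lambda>s. form_B (x s * n2 s) (x s * n3 s) (x s * n4 s))"
    using parallel_frame_if_type_D[OF I D] .
  define q where "q s = 1 / sqrt (n2 s * n2 s + n3 s * n3 s)" for s
  define p where "p s = q s * n2 s" for s
  define r where "r s = q s * n3 s" for s
  have pos: "n2 s * n2 s + n3 s * n3 s > 0" if "s \<in> I" for s
    using nz that by (metis sum_squares_gt_zero_iff)
  have "smooth_on I q"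
    unfolding q_def by (intro smooth_on_inverse_sqrt smooth_on_add smooth_on_mult sm I pos)
  then have pr: "smooth_on I p" "smooth_on I r"
    unfolding p_def r_def by (intro smooth_on_mult sm I; assumption)+
  define p' where "p' s = vector_derivative p (at s)" for s
  define r' where "r' s = vector_derivative r (at s)" for s
  have p'r': "smooth_on I p'" "smooth_on I r'"
    unfolding p'_def r'_def by (intro smooth_on_vector_derivative pr)+
  have p': "(p has_vector_derivative p' s) (at s)" and r': "(r has_vector_derivative r' s) (at s)"
    if "s \<in> I" for s
    using pr[THEN smooth_on_has_vector_derivative, OF that] unfolding p'_def r'_def by auto
  have unit: "p s * p s + r s * r s = 1" if "s \<in> I" for s
  proof -
    have "q s * q s * (n2 s * n2 s + n3 s * n3 s) = 1"
      using pos[OF that] unfolding q_def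
      by (metis less_imp_le less_irrefl mult_1 nonzero_eq_divide_eq real_sqrt_mult_self
          times_divide_times_eq abs_of_nonneg)
    then show ?thesis unfolding p_def r_def by algebra
  qed
  have unit': "p s * p' s + r s * r' s = 0" if s: "s \<in> I" for s
  proof -
    have "((\<lambda>s. p s * p s + r s * r s) has_vector_derivative
        (p s * p' s + p' s * p s) + (r s * r' s + r' s * r s)) (at s)"
      by (intro has_vector_derivative_add has_vector_derivative_mult p' r' s)
    moreover have "((\<lambda>s. p s * p s + r s * r s) has_vector_derivative 0) (at s)"
      by (rule has_vector_derivative_transform_within_open[of "\<lambda>_. 1", OF _ I(1) s])
        (simp_all add: unit)
    ultimately have "(p s * p' s + p' s * p s) + (r s * r' s + r' s * r s) = 0"
      by (rule vector_derivative_unique_at)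
    then show ?thesis by (simp add: mult.commute)
  qed
  define V :: "real \<Rightarrow> real^4^4" where "V s = vector
     [vector [1,     0,   0, 0],
      vector [0,   p s, r s, 0],
      vector [0,     0,   0, 1],
      vector [0, - r s, p s, 0]]" for s
  define V' :: "real \<Rightarrow> real^4^4" where "V' s = vector
     [vector [0,      0,    0, 0],
      vector [0,   p' s, r' s, 0],
      vector [0,      0,    0, 0],
      vector [0, - r' s, p' s, 0]]" for s
  define y1 where "y1 s = x s * n2 s * p s + x s * n3 s * r s" for s
  define y3 where "y3 s = p s * r' s + - (r s * p' s)" for s
  have y: "smooth_on I y1" "smooth_on I (\<lambda>s. x s * n4 s)" "smooth_on I y3"
    unfolding y1_def y3_def
    by (intro smooth_on_add smooth_on_minus smooth_on_mult sm pr p'r' I)+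
  have V: "smooth_on I V"
  proof (rule smooth_on_matrix[OF I(1)])
    have "\<forall>i j. smooth_on I (\<lambda>s. V s $ i $ j)"
      unfolding forall_4 V_def vector_4 by (intro conjI smooth_on_const smooth_on_minus pr I)
    then show "smooth_on I (\<lambda>s. V s $ i $ j)" for i j by blast
  qed
  have V_orth: "orthogonal_matrix (V s)" if "s \<in> I" for s
    using unit[OF that] unfolding orthogonal_matrix
    by (simp add: vec_eq_iff forall_4 matrix_matrix_mult_def transpose_def sum_4 V_def vector_4
        mat_def add.commute)
  have V_1: "V s $ 1 = axis 1 1" if "s \<in> I" for s
    by (simp add: V_def vector_4 vec_eq_iff forall_4 axis_def)
  have V_deriv: "(V has_vector_derivative form_C (y1 s) (x s * n4 s) (y3 s) ** V s -
      V s ** form_B (x s * n2 s) (x s * n3 s) (x s * n4 s)) (at s)" if s: "s \<in> I" for s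
  proof -
    have "\<forall>i j. ((\<lambda>s. V s $ i $ j) has_vector_derivative V' s $ i $ j) (at s)"
      unfolding forall_4 V_def V'_def vector_4
      by (intro conjI has_vector_derivative_const has_vector_derivative_minus p' r' s)
    then have "((\<lambda>s. \<chi> i j. V s $ i $ j) has_vector_derivative (\<chi> i j. V' s $ i $ j)) (at s)"
      by (intro has_vector_derivative_vec_lambda) blast
    moreover have "form_C (y1 s) (x s * n4 s) (y3 s) ** V s -
        V s ** form_B (x s * n2 s) (x s * n3 s) (x s * n4 s) = V' s"
    proof -
      \<comment> \<open>\<open>(p, r)\<close> is parallel to \<open>(n2, n3)\<close>, which removes the tangential part of \<open>W\<^sub>3'\<close>.\<close>
      have pr_n: "p s * n3 s = r s * n2 s" by (simp add: p_def r_def)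
      have "y1 s * p s = x s * n2 s" "y1 s * r s = x s * n3 s"
        using unit[OF s] pr_n unfolding y1_def by algebra+
      moreover have "- (y3 s * r s) = p' s" "y3 s * p s = r' s"
        using unit[OF s] unit'[OF s] unfolding y3_def by algebra+
      moreover have "r s * (x s * n2 s) = p s * (x s * n3 s)"
        using pr_n by algebra
      moreover have "y1 s = p s * (x s * n2 s) + r s * (x s * n3 s)"
        by (simp add: y1_def algebra_simps)
      ultimately show ?thesis
        by (simp add: vec_eq_iff forall_4 matrix_matrix_mult_def sum_4 form_B_def form_C_def
            V_def V'_def vector_4)
    qed
    ultimately show ?thesis by simp
  qed
  note gauge = gauge_transformation[OF I(1) Z1 Z2 V V_orth V_1 V_deriv]
  show ?thesis
    unfolding admits_bishop_frame_iff[OF I(1)] using gauge y by blast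
qed

theorem theorem1p2:
  fixes I :: "real set" and \<gamma> :: "real \<Rightarrow> real^4"
  assumes "regular_timelike_curve I \<gamma>"
    and "proper_time_parametrized I \<gamma>"
  shows "(admits_bishop_frame form_F I \<gamma> \<longrightarrow> admits_bishop_frame form_D I \<gamma>) \<and>
         (admits_bishop_frame form_D I \<gamma> \<longrightarrow> admits_bishop_frame form_C I \<gamma>)"
proof -
  have I: "open I" "is_interval I"
    using assms(1) by (auto simp: regular_timelike_curve_def)
  show ?thesis
    using admits_type_D_if_type_F[OF I] admits_type_C_if_type_D[OF I] by blast
qed

end
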